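(* Let $f,\nu:\mathbb{Z}^2\to\mathbb{R}^4\setminus\{0\}$ satisfy $\langle f,\nu\rangle=0$ and be related by the discrete projective Lelieuvre map, i.e. $f\wedge f_1=\star(\nu\wedge\nu_1)$ and $f\wedge f_2=-\star(\nu\wedge\nu_2)$ on $\mathbb{Z}^2$. Then $$\det|f,f_1,f_2,f_{12}|=\det|\nu,\nu_1,\nu_2,\nu_{12}|.$$
   Context: $f$ and $\nu$ are homogeneous coordinate vectors of discrete surfaces in $P^3$ and in the dual space $P_3$, depending on integers $(n_1,n_2)$. Subscripts on $f$ and $\nu$ denote shifts, not components: $f_1(n_1,n_2)=f(n_1+1,n_2)$, $f_2(n_1,n_2)=f(n_1,n_2+1)$, $f_{12}(n_1,n_2)=f(n_1+1,n_2+1)$, and similarly for $\nu$. $\langle a,b\rangle=\sum_{i=1}^4a_ib_i$ for vectors $a,b\in\mathbb{R}^4$. $\varepsilon$ is the totally alternating symbol with $\varepsilon_{1234}=1$; for vectors $a,b\in\mathbb{R}^4$ with components $a_i,b_i$, $(a\wedge b)_{ik}=a_ib_k-a_kb_i$; for a skew-symmetric $T$, $(\star T)_{ik}=\frac12\sum_{l,m}\varepsilon_{lmik}T_{lm}$. Hence $(\star(a\wedge b))_{ik}=\sum_{l,m}\varepsilon_{iklm}a_lb_m$. $\det|a,b,c,d|$ is the determinant of the matrix formed by the four vectors. *)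

theory Defs
  imports "HOL-Analysis.Analysis" "HOL-Combinatorics.Permutations"
begin

(* The index type 4 has the elements 1, 2, 3 and 4 = 0. *)

definition alternating :: "4 \<Rightarrow> 4 \<Rightarrow> 4 \<Rightarrow> 4 \<Rightarrow> real" where
  "alternating i k l m =
     (let \<sigma> = (\<lambda>j. (vector [i, k, l, m] :: 4 ^ 4) $ j)
      in if bij \<sigma> then of_int (sign \<sigma>) else 0)"

definition wedge :: "real ^ 4 \<Rightarrow> real ^ 4 \<Rightarrow> real ^ 4 ^ 4" where
  "wedge a b = (\<chi> i k. a $ i * b $ k - a $ k * b $ i)"

(* Only meant for skew-symmetric arguments. *)
definition hodge_star :: "real ^ 4 ^ 4 \<Rightarrow> real ^ 4 ^ 4" where
  "hodge_star T = (\<chi> i k. (1 / 2) * (\<Sum>l\<in>UNIV. \<Sum>m\<in>UNIV. alternating l m i k * T $ l $ m))"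

definition det4 :: "real ^ 4 \<Rightarrow> real ^ 4 \<Rightarrow> real ^ 4 \<Rightarrow> real ^ 4 \<Rightarrow> real" where
  "det4 a b c d = det (vector [a, b, c, d] :: real ^ 4 ^ 4)"

definition shift1 :: "(int \<Rightarrow> int \<Rightarrow> 'a) \<Rightarrow> int \<Rightarrow> int \<Rightarrow> 'a" where
  "shift1 f n1 n2 = f (n1 + 1) n2"

definition shift2 :: "(int \<Rightarrow> int \<Rightarrow> 'a) \<Rightarrow> int \<Rightarrow> int \<Rightarrow> 'a" where
  "shift2 f n1 n2 = f n1 (n2 + 1)"

definition discrete_projective_lelieuvre ::
    "(int \<Rightarrow> int \<Rightarrow> real ^ 4) \<Rightarrow> (int \<Rightarrow> int \<Rightarrow> real ^ 4) \<Rightarrow> bool" where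
  "discrete_projective_lelieuvre f \<nu> \<longleftrightarrow>
     (\<forall>n1 n2.
        wedge (f n1 n2) (shift1 f n1 n2) = hodge_star (wedge (\<nu> n1 n2) (shift1 \<nu> n1 n2)) \<and>
        wedge (f n1 n2) (shift2 f n1 n2) = - hodge_star (wedge (\<nu> n1 n2) (shift2 \<nu> n1 n2)))"

lemma vector_4:
  "(vector [a, b, c, d] :: ('a::zero) ^ 4) $ 1 = a"
  "(vector [a, b, c, d] :: ('a::zero) ^ 4) $ 2 = b"
  "(vector [a, b, c, d] :: ('a::zero) ^ 4) $ 3 = c"
  "(vector [a, b, c, d] :: ('a::zero) ^ 4) $ 4 = d"
  unfolding vector_def by simp_all

lemma alternating_1234: "alternating 1 2 3 4 = 1"
proof -
  have "(\<lambda>j. (vector [1, 2, 3, 4] :: 4 ^ 4) $ j) = id"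
    unfolding fun_eq_iff forall_4 by (simp add: vector_4)
  then show ?thesis by (simp add: alternating_def sign_id Let_def bij_id [unfolded id_def])
qed

lemma alternating_swap:
  "alternating k i l m = - alternating i k l m"
  "alternating i l k m = - alternating i k l m"
  "alternating i k m l = - alternating i k l m"
proof -
  have *: "(if bij \<tau> then real_of_int (sign \<tau>) else 0) =
      - (if bij \<sigma> then real_of_int (sign \<sigma>) else 0)"
    if eq: "\<tau> = \<sigma> \<circ> Transposition.transpose p q" and pq: "p \<noteq> q" for \<sigma> \<tau> :: "4 \<Rightarrow> 4" and p q
  proof (cases "bij \<sigma>")
    case True
    then have "permutation \<sigma>" by (simp add: permutation)
    then have "sign \<tau> = - sign \<sigma>"
      using pq by (simp add: eq sign_compose permutation_swap_id sign_swap_id)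
    moreover have "bij \<tau>" using True by (simp add: eq bij_comp)
    ultimately show ?thesis using True by simp
  next
    case False
    have "\<sigma> = \<tau> \<circ> Transposition.transpose p q" by (simp add: eq comp_assoc)
    then have "\<not> bij \<tau>" using False bij_comp bij_swap_iff by metis
    then show ?thesis using False by simp
  qed
  show "alternating k i l m = - alternating i k l m"
    unfolding alternating_def Let_def
    by (rule * [of _ _ 1 2]) (simp_all add: fun_eq_iff forall_4 vector_4 Transposition.transpose_def)
  show "alternating i l k m = - alternating i k l m"
    unfolding alternating_def Let_def
    by (rule * [of _ _ 2 3]) (simp_all add: fun_eq_iff forall_4 vector_4 Transposition.transpose_def)
  show "alternating i k m l = - alternating i k l m"
    unfolding alternating_def Let_def
    by (rule * [of _ _ 3 4]) (simp_all add: fun_eq_iff forall_4 vector_4 Transposition.transpose_def)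
qed

lemma hodge_star_wedge:
  "hodge_star (wedge a b) $ i $ k =
     (\<Sum>l\<in>UNIV. \<Sum>m\<in>UNIV. alternating i k l m * (a $ l * b $ m))"
proof -
  have pair: "alternating l m i k = alternating i k l m" for l m
    using alternating_swap(2)[of l m i k] alternating_swap(1)[of l i m k]
      alternating_swap(3)[of i l m k] alternating_swap(2)[of i l k m] by simp
  let ?S = "\<Sum>l\<in>UNIV. \<Sum>m\<in>UNIV. alternating i k l m * (a $ l * b $ m)"
  have "(\<Sum>l\<in>UNIV. \<Sum>m\<in>UNIV. alternating i k l m * (a $ m * b $ l)) =
      (\<Sum>m\<in>UNIV. \<Sum>l\<in>UNIV. alternating i k l m * (a $ m * b $ l))"
    by (rule sum.swap)
  also have "\<dots> = - ?S"
    unfolding sum_negf [symmetric]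
    by (intro sum.cong refl) (subst alternating_swap(3), simp)
  finally show ?thesis
    by (simp add: hodge_star_def wedge_def pair right_diff_distrib sum_subtractf)
qed

end

theory Submission
  imports Defs
begin

text \<open>
  By Laplace expansion along pairs of rows, \<open>det |a, b, c, d|\<close> is the wedge pairing of the
  bivectors \<open>a \<and> b\<close> and \<open>c \<and> d\<close>, and the Hodge star in dimension four preserves this pairing.
  Apply this to the two parallel edges of a quadrilateral in the first lattice direction, where both
  Lelieuvre equations carry the same sign.
\<close>

text \<open>The coefficient of \<open>e1 \<and> e2 \<and> e3 \<and> e4\<close> in the product of two
  bivectors. Only entries above the diagonal are read, as these determine a skew-symmetric
  matrix.\<close>

definition wedge_pairing :: "real ^ 4 ^ 4 \<Rightarrow> real ^ 4 ^ 4 \<Rightarrow> real" where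
  "wedge_pairing S T =
     S $ 1 $ 2 * T $ 3 $ 4 - S $ 1 $ 3 * T $ 2 $ 4 + S $ 1 $ 4 * T $ 2 $ 3
     + S $ 2 $ 3 * T $ 1 $ 4 - S $ 2 $ 4 * T $ 1 $ 3 + S $ 3 $ 4 * T $ 1 $ 2"

text \<open>The 24 Leibniz terms are grouped as minors of the first two rows times complementary
  minors of the last two, so that each factor is an entry of a \<open>wedge\<close>.\<close>

lemma det_4:
  fixes A :: "'a::comm_ring_1 ^ 4 ^ 4"
  shows "det A =
    (A $ 1 $ 1 * A $ 2 $ 2 - A $ 1 $ 2 * A $ 2 $ 1) * (A $ 3 $ 3 * A $ 4 $ 4 - A $ 3 $ 4 * A $ 4 $ 3)
    - (A $ 1 $ 1 * A $ 2 $ 3 - A $ 1 $ 3 * A $ 2 $ 1) * (A $ 3 $ 2 * A $ 4 $ 4 - A $ 3 $ 4 * A $ 4 $ 2)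
    + (A $ 1 $ 1 * A $ 2 $ 4 - A $ 1 $ 4 * A $ 2 $ 1) * (A $ 3 $ 2 * A $ 4 $ 3 - A $ 3 $ 3 * A $ 4 $ 2)
    + (A $ 1 $ 2 * A $ 2 $ 3 - A $ 1 $ 3 * A $ 2 $ 2) * (A $ 3 $ 1 * A $ 4 $ 4 - A $ 3 $ 4 * A $ 4 $ 1)
    - (A $ 1 $ 2 * A $ 2 $ 4 - A $ 1 $ 4 * A $ 2 $ 2) * (A $ 3 $ 1 * A $ 4 $ 3 - A $ 3 $ 3 * A $ 4 $ 1)
    + (A $ 1 $ 3 * A $ 2 $ 4 - A $ 1 $ 4 * A $ 2 $ 3) * (A $ 3 $ 1 * A $ 4 $ 2 - A $ 3 $ 2 * A $ 4 $ 1)"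
proof -
  have f1234: "finite {2::4, 3, 4}" "1 \<notin> {2::4, 3, 4}"
    and f234: "finite {3::4, 4}" "2 \<notin> {3::4, 4}"
    and f34: "finite {4::4}" "3 \<notin> {4::4}"
    by auto
  show ?thesis
    unfolding det_def UNIV_4
    \<comment> \<open>Each permutation of an enlarged set is a transposition moving the new index
      composed with a permutation of the rest; the indices 1, 2, 3 are split off in turn.\<close>
    unfolding sum_over_permutations_insert[OF f1234]
    unfolding sum_over_permutations_insert[OF f234]
    unfolding sum_over_permutations_insert[OF f34]
    unfolding permutes_sing
    by (simp add: sign_swap_id permutation_swap_id sign_compose sign_id permutation_compose
        Transposition.transpose_def algebra_simps)
qed

lemma det4_eq_wedge_pairing: "det4 a b c d = wedge_pairing (wedge a b) (wedge c d)"
  by (simp add: det4_def det_4 vector_4 wedge_pairing_def wedge_def algebra_simps)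

text \<open>Swapping equal neighbours changes the sign but not the term, so the value is 0; equal
  arguments further apart are first made adjacent by swaps.\<close>

lemma alternating_eq_0:
  "alternating i i l m = 0" "alternating i k k m = 0" "alternating i k l l = 0"
  "alternating i k i m = 0" "alternating i k l k = 0" "alternating i k l i = 0"
proof -
  show *: "alternating i i l m = 0" "alternating i k k m = 0" "alternating i k l l = 0" for i k l m
    using alternating_swap(1)[of i i l m] alternating_swap(2)[of i k k m]
      alternating_swap(3)[of i k l l] by simp_all
  show **: "alternating i k i m = 0" "alternating i k l k = 0" for i k l m
    using alternating_swap(1)[of i k i m] alternating_swap(3)[of i k l k] * by simp_all
  show "alternating i k l i = 0"
    using alternating_swap(1)[of i k l i] ** by simp
qed

lemma alternating_values:
  "alternating 1 2 3 4 = 1" "alternating 1 2 4 3 = - 1"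
  "alternating 1 3 2 4 = - 1" "alternating 1 3 4 2 = 1"
  "alternating 1 4 2 3 = 1" "alternating 1 4 3 2 = - 1"
  "alternating 2 3 1 4 = 1" "alternating 2 3 4 1 = - 1"
  "alternating 2 4 1 3 = - 1" "alternating 2 4 3 1 = 1"
  "alternating 3 4 1 2 = 1" "alternating 3 4 2 1 = - 1"
proof -
  note swap = alternating_swap
  show 1: "alternating 1 2 3 4 = 1" by (rule alternating_1234)
  then show 2: "alternating 1 2 4 3 = - 1" using swap(3)[of 1 2 4 3] by simp
  show "alternating 1 3 2 4 = - 1" using swap(2)[of 1 3 2 4] 1 by simp
  then show 4: "alternating 1 3 4 2 = 1" using swap(3)[of 1 3 4 2] by simp
  show "alternating 1 4 2 3 = 1" using swap(2)[of 1 4 2 3] 2 by simp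
  then show "alternating 1 4 3 2 = - 1" using swap(3)[of 1 4 3 2] by simp
  show "alternating 2 3 1 4 = 1"
    using swap(2)[of 2 3 1 4] swap(1)[of 2 1 3 4] 1 by simp
  then show "alternating 2 3 4 1 = - 1" using swap(3)[of 2 3 4 1] by simp
  show "alternating 2 4 1 3 = - 1"
    using swap(2)[of 2 4 1 3] swap(1)[of 2 1 4 3] 2 by simp
  then show "alternating 2 4 3 1 = 1" using swap(3)[of 2 4 3 1] by simp
  show "alternating 3 4 1 2 = 1"
    using swap(2)[of 3 4 1 2] swap(1)[of 3 1 4 2] 4 by simp
  then show "alternating 3 4 2 1 = - 1" using swap(3)[of 3 4 2 1] by simp
qed

text \<open>For fixed \<open>i\<close> and \<open>k\<close> only the two orderings of the
  complementary indices survive in the double sum, and their opposite signs form one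
  \<open>wedge\<close> entry.\<close>

lemma hodge_star_wedge_component:
  "hodge_star (wedge a b) $ 1 $ 2 = wedge a b $ 3 $ 4"
  "hodge_star (wedge a b) $ 1 $ 3 = - wedge a b $ 2 $ 4"
  "hodge_star (wedge a b) $ 1 $ 4 = wedge a b $ 2 $ 3"
  "hodge_star (wedge a b) $ 2 $ 3 = wedge a b $ 1 $ 4"
  "hodge_star (wedge a b) $ 2 $ 4 = - wedge a b $ 1 $ 3"
  "hodge_star (wedge a b) $ 3 $ 4 = wedge a b $ 1 $ 2"
  unfolding hodge_star_wedge sum_4
  by (simp_all add: alternating_eq_0 alternating_values wedge_def)

text \<open>The star exchanges complementary entries and so swaps the six products in pairs. Its two
  minus signs, at (1,3) and (2,4), meet in the same products and cancel.\<close>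

lemma wedge_pairing_hodge_star:
  "wedge_pairing (hodge_star (wedge a b)) (hodge_star (wedge c d)) =
   wedge_pairing (wedge a b) (wedge c d)"
  by (simp add: wedge_pairing_def hodge_star_wedge_component)

theorem theorem5p2:
  fixes f \<nu> :: "int \<Rightarrow> int \<Rightarrow> real ^ 4"
  assumes f_nonzero: "\<And>n1 n2. f n1 n2 \<noteq> 0"
    and nu_nonzero: "\<And>n1 n2. \<nu> n1 n2 \<noteq> 0"
    and incidence: "\<And>n1 n2. f n1 n2 \<bullet> \<nu> n1 n2 = 0"
    and lelieuvre: "discrete_projective_lelieuvre f \<nu>"
  shows "\<forall>n1 n2.
    det4 (f n1 n2) (shift1 f n1 n2) (shift2 f n1 n2) (shift1 (shift2 f) n1 n2) =
    det4 (\<nu> n1 n2) (shift1 \<nu> n1 n2) (shift2 \<nu> n1 n2) (shift1 (shift2 \<nu>) n1 n2)"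
proof (intro allI)
  fix n1 n2
  \<comment> \<open>The second equation is the first-direction relation taken at
    \<open>(n1, n2 + 1)\<close>.\<close>
  have "wedge (f n1 n2) (shift1 f n1 n2) = hodge_star (wedge (\<nu> n1 n2) (shift1 \<nu> n1 n2))"
    and "wedge (shift2 f n1 n2) (shift1 (shift2 f) n1 n2) =
      hodge_star (wedge (shift2 \<nu> n1 n2) (shift1 (shift2 \<nu>) n1 n2))"
    using lelieuvre by (simp_all add: discrete_projective_lelieuvre_def shift1_def shift2_def)
  then show "det4 (f n1 n2) (shift1 f n1 n2) (shift2 f n1 n2) (shift1 (shift2 f) n1 n2) =
    det4 (\<nu> n1 n2) (shift1 \<nu> n1 n2) (shift2 \<nu> n1 n2) (shift1 (shift2 \<nu>) n1 n2)"
    by (simp add: det4_eq_wedge_pairing wedge_pairing_hodge_star)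
qed

end
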